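(* If $G$ is a graph, and $X$ is the set of end-vertices of all maximal geodesics of $G$, then $\mathrm{gt}(G)\le |X|-1$. In addition, if there is a subset $X'\subset X$ such that no maximal geodesic lies between two vertices from $X'$, then $\mathrm{gt}(G)\le |X|-|X'|$.
   Context: A geodesic in a graph $G$ is a shortest path between two vertices. A geodesic is maximal if it is not a subpath of another geodesic of $G$. A set $S\subseteq V(G)$ is a geodesic transversal of $G$ if every maximal geodesic of $G$ contains at least one vertex of $S$. The geodesic transversal number $\mathrm{gt}(G)$ is the minimum cardinality of a geodesic transversal of $G$.
   Formalization: The first bound assumes G has at least one edge (it fails for edgeless graphs, where gt(G)=|X|); in the second, the two vertices of X' may coincide, so X' contains no isolated vertex (otherwise K_2 + K_1 is a counterexample). *)

theory Defs
  imports "Graph_Theory.Graph_Theory" "HOL-Library.Sublist"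
begin

text \<open>
  A finite simple undirected graph is an instance of the locale \<open>graph\<close>: a finite, symmetric,
  loopfree digraph without parallel arcs.  A path is represented by the list of its vertices
  (\<open>vpath\<close>, nonempty and without repetition); a one-vertex list is a path of length 0.
\<close>

definition geodesic :: "('a, 'b) pre_digraph \<Rightarrow> 'a list \<Rightarrow> bool" where
  "geodesic G p \<longleftrightarrow>
     vpath p G \<and>
     (\<forall>q. vpath q G \<and> hd q = hd p \<and> last q = last p \<longrightarrow> vwalk_length p \<le> vwalk_length q)"

text \<open>
  Paths are undirected, so the lists \<open>p\<close> and \<open>rev p\<close> describe the same path.
\<close>

definition same_path :: "'a list \<Rightarrow> 'a list \<Rightarrow> bool" where
  "same_path p q \<longleftrightarrow> p = q \<or> p = rev q"

definition subpath :: "'a list \<Rightarrow> 'a list \<Rightarrow> bool" where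
  "subpath p q \<longleftrightarrow> sublist p q \<or> sublist p (rev q)"

definition maximal_geodesic :: "('a, 'b) pre_digraph \<Rightarrow> 'a list \<Rightarrow> bool" where
  "maximal_geodesic G p \<longleftrightarrow>
     geodesic G p \<and> \<not> (\<exists>q. geodesic G q \<and> \<not> same_path p q \<and> subpath p q)"

definition geodesic_transversal :: "('a, 'b) pre_digraph \<Rightarrow> 'a set \<Rightarrow> bool" where
  "geodesic_transversal G S \<longleftrightarrow>
     S \<subseteq> verts G \<and> (\<forall>p. maximal_geodesic G p \<longrightarrow> set p \<inter> S \<noteq> {})"

definition gt :: "('a, 'b) pre_digraph \<Rightarrow> nat" where
  "gt G = (LEAST k. \<exists>S. geodesic_transversal G S \<and> card S = k)"

definition geodesic_ends :: "('a, 'b) pre_digraph \<Rightarrow> 'a set" where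
  "geodesic_ends G = (\<Union>p\<in>{p. maximal_geodesic G p}. {hd p, last p})"

text \<open>
  The two end-vertices are not required to be distinct.  They coincide only for the one-vertex
  path at an isolated vertex.
\<close>

definition maximal_geodesic_between :: "('a, 'b) pre_digraph \<Rightarrow> 'a \<Rightarrow> 'a \<Rightarrow> bool" where
  "maximal_geodesic_between G u v \<longleftrightarrow> (\<exists>p. maximal_geodesic G p \<and> hd p = u \<and> last p = v)"

end

theory Submission
  imports Defs
begin

text \<open>
  Deleting from the set of end-vertices a subset that contains no two (possibly equal) ends of one
  maximal geodesic leaves a transversal.  For the first bound, delete one end \<open>x\<close> of a longest
  geodesic: the only geodesic from \<open>x\<close> to \<open>x\<close> is trivial, and it is not maximal because it extends
  to the longest one.
\<close>

lemma gt_le_card: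
  assumes "geodesic_transversal G S"
  shows "gt G \<le> card S"
  unfolding gt_def by (rule Least_le) (use assms in blast)

lemma maximal_geodesic_vpath: "maximal_geodesic G p \<Longrightarrow> vpath p G"
  by (simp add: maximal_geodesic_def geodesic_def)

lemma vpath_nonempty: "vpath p G \<Longrightarrow> p \<noteq> []"
  by (auto simp: vpath_def vwalk_def)

lemma vpath_set_subset: "vpath p G \<Longrightarrow> set p \<subseteq> verts G"
  by (auto simp: vpath_def vwalk_def)

lemma geodesic_ends_subset: "geodesic_ends G \<subseteq> verts G"
proof -
  have "hd p \<in> verts G \<and> last p \<in> verts G" if "maximal_geodesic G p" for p
  proof -
    have "vpath p G"
      using that by (rule maximal_geodesic_vpath)
    then have "p \<noteq> []" "set p \<subseteq> verts G"
      by (rule vpath_nonempty, rule vpath_set_subset)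
    then show ?thesis
      by (auto dest: hd_in_set last_in_set)
  qed
  then show ?thesis
    by (auto simp: geodesic_ends_def)
qed

text \<open>Each maximal geodesic keeps an end outside \<open>X\<close>. The case
  \<open>u = v\<close> matters: it bars isolated vertices from \<open>X\<close>, whose one-vertex
  geodesics would otherwise be missed.\<close>

lemma geodesic_transversal_ends_Diff:
  assumes "\<And>u v. u \<in> X \<Longrightarrow> v \<in> X \<Longrightarrow> \<not> maximal_geodesic_between G u v"
  shows "geodesic_transversal G (geodesic_ends G - X)"
  unfolding geodesic_transversal_def
proof (intro conjI allI impI)
  show "geodesic_ends G - X \<subseteq> verts G"
    using geodesic_ends_subset[of G] by blast
next
  fix p assume p: "maximal_geodesic G p"
  then have "hd p \<in> set p" "last p \<in> set p"
    by (simp_all add: vpath_nonempty[OF maximal_geodesic_vpath])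
  moreover have "hd p \<in> geodesic_ends G" "last p \<in> geodesic_ends G"
    using p by (auto simp: geodesic_ends_def)
  moreover have "hd p \<notin> X \<or> last p \<notin> X"
    using assms p by (auto simp: maximal_geodesic_between_def)
  ultimately show "set p \<inter> (geodesic_ends G - X) \<noteq> {}"
    by blast
qed

lemma gt_le_card_ends_Diff:
  assumes "finite (verts G)" "X \<subseteq> geodesic_ends G"
    and "\<And>u v. u \<in> X \<Longrightarrow> v \<in> X \<Longrightarrow> \<not> maximal_geodesic_between G u v"
  shows "int (gt G) \<le> int (card (geodesic_ends G)) - int (card X)"
proof -
  have fin: "finite (geodesic_ends G)"
    using geodesic_ends_subset assms(1) by (rule finite_subset)
  have "gt G \<le> card (geodesic_ends G - X)"
    using assms(3) by (intro gt_le_card geodesic_transversal_ends_Diff)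
  also have "\<dots> = card (geodesic_ends G) - card X"
    using finite_subset[OF assms(2) fin] assms(2) by (rule card_Diff_subset)
  \<comment> \<open>Since \<open>card X\<close> is at most \<open>card (geodesic_ends G)\<close>,
    the truncated difference on naturals agrees with the integer one.\<close>
  finally show ?thesis
    using card_mono[OF fin assms(2)] by linarith
qed

lemma same_path_if_subpath_length_le:
  assumes "subpath p q" "length q \<le> length p"
  shows "same_path p q"
proof -
  \<comment> \<open>Here \<open>r\<close> stands for either orientation of \<open>q\<close>. The
    length bound leaves no room for a prefix or suffix around \<open>p\<close>.\<close>
  have "p = r" if "sublist p r" "length r = length q" for r
  proof -
    obtain xs ys where "r = xs @ p @ ys"
      using \<open>sublist p r\<close> by (auto simp: sublist_def)
    moreover from this have "length r = length xs + length p + length ys"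
      by simp
    then have "length xs + length ys = 0"
      using that(2) assms(2) by linarith
    ultimately show ?thesis by simp
  qed
  from this[of q] this[of "rev q"] show ?thesis
    using assms(1) by (auto simp: subpath_def same_path_def)
qed

text \<open>Vertices on a path are distinct, so lengths are bounded by the order of the graph;
  \<open>p\<^sub>0\<close> ensures that there is a length to maximise.\<close>

lemma exists_longest_geodesic:
  assumes "finite (verts G)" "geodesic G p\<^sub>0"
  obtains p where "geodesic G p" "\<And>q. geodesic G q \<Longrightarrow> length q \<le> length p"
proof -
  have "length q < Suc (card (verts G))" if "geodesic G q" for q
  proof -
    have "vpath q G"
      using that by (simp add: geodesic_def)
    then have "distinct q" "set q \<subseteq> verts G"
      by (simp_all add: vpath_def vpath_set_subset)
    then show ?thesis
      using card_mono[OF assms(1), of "set q"] by (simp add: distinct_card)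
  qed
  then show thesis
    using ex_has_greatest_nat[of "geodesic G" p\<^sub>0 length] assms(2) that by blast
qed

lemma maximal_geodesic_if_longest:
  assumes "geodesic G p" "\<And>q. geodesic G q \<Longrightarrow> length q \<le> length p"
  shows "maximal_geodesic G p"
  using assms same_path_if_subpath_length_le by (auto simp: maximal_geodesic_def)

text \<open>A path between distinct vertices has at least one arc. This supplies a geodesic on two
  vertices, so that a longest one is not trivial.\<close>

lemma geodesic_arc:
  assumes "u \<noteq> v" "u \<rightarrow>\<^bsub>G\<^esub> v" "u \<in> verts G" "v \<in> verts G"
  shows "geodesic G [u, v]"
  unfolding geodesic_def
proof (intro conjI allI impI)
  show "vpath [u, v] G"
    using assms by (auto simp: vpath_def vwalk_def)
next
  fix q assume q: "vpath q G \<and> hd q = hd [u, v] \<and> last q = last [u, v]"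
  then obtain a as where "q = a # as"
    using vpath_nonempty by (metis neq_Nil_conv)
  with q assms(1) show "vwalk_length [u, v] \<le> vwalk_length q"
    by (cases as) auto
qed

lemma no_closed_maximal_geodesic:
  assumes p: "geodesic G p" and len: "2 \<le> length p"
  shows "\<not> maximal_geodesic_between G (hd p) (hd p)"
proof
  assume "maximal_geodesic_between G (hd p) (hd p)"
  then obtain q where q: "maximal_geodesic G q" "hd q = hd p" "last q = hd p"
    by (auto simp: maximal_geodesic_between_def)
  have "vpath q G"
    using q(1) by (rule maximal_geodesic_vpath)
  then have "q \<noteq> []" "distinct q"
    by (auto simp: vpath_nonempty vpath_def)
  \<comment> \<open>A repetition-free list whose first and last entries agree has only one
    entry.\<close>
  then have "q = [hd p]"
    using q by (cases q) (auto split: if_splits dest: last_in_set)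
  moreover have "sublist [hd p] p"
    using len by (cases p) auto
  ultimately have "subpath q p"
    by (simp add: subpath_def)
  moreover have "\<not> same_path q p"
    using len \<open>q = [hd p]\<close> unfolding same_path_def
    by (metis One_nat_def Suc_1 length_Cons length_rev list.size(3) not_less_eq_eq order_refl)
  ultimately show False
    using q(1) p by (auto simp: maximal_geodesic_def)
qed

theorem mainTheorem1:
  fixes G :: "('a, 'b) pre_digraph"
  assumes "graph G"
  shows "(arcs G \<noteq> {} \<longrightarrow> int (gt G) \<le> int (card (geodesic_ends G)) - 1) \<and>
         (\<forall>X'. X' \<subseteq> geodesic_ends G \<and>
               (\<forall>u\<in>X'. \<forall>v\<in>X'. \<not> maximal_geodesic_between G u v) \<longrightarrow>
               int (gt G) \<le> int (card (geodesic_ends G)) - int (card X'))"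
proof (intro conjI impI allI)
  interpret graph G by fact
  show "int (gt G) \<le> int (card (geodesic_ends G)) - int (card X')"
    if "X' \<subseteq> geodesic_ends G \<and>
      (\<forall>u\<in>X'. \<forall>v\<in>X'. \<not> maximal_geodesic_between G u v)" for X'
    using that gt_le_card_ends_Diff[OF finite_verts] by blast
  \<comment> \<open>Without arcs the maximal geodesics are exactly the single vertices, so
    \<open>gt G\<close> equals the number of ends and this bound fails.\<close>
  show "int (gt G) \<le> int (card (geodesic_ends G)) - 1" if nonempty: "arcs G \<noteq> {}"
  proof -
    obtain e where e: "e \<in> arcs G"
      using nonempty by blast
    have arc: "geodesic G [tail G e, head G e]"
      using e by (intro geodesic_arc) (auto dest: no_loops intro: in_arcs_imp_in_arcs_ends)
    then obtain p where p: "geodesic G p" "\<And>q. geodesic G q \<Longrightarrow> length q \<le> length p"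
      using exists_longest_geodesic finite_verts by blast
    have "2 \<le> length p"
      using p(2)[OF arc] by simp
    then have "\<not> maximal_geodesic_between G (hd p) (hd p)"
      using no_closed_maximal_geodesic p(1) by blast
    moreover have "hd p \<in> geodesic_ends G"
      using maximal_geodesic_if_longest[OF p] by (auto simp: geodesic_ends_def)
    \<comment> \<open>For the singleton \<open>{hd p}\<close> the only pair to exclude is
      \<open>hd p\<close> with itself.\<close>
    ultimately show ?thesis
      using gt_le_card_ends_Diff[OF finite_verts, of "{hd p}"] by simp
  qed
qed

end
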